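(* Let $D$ be an integrally closed integral domain such that $1<|\mathcal{K}(D)|<\infty$. Then there is a minimal valuation overring $V$ of $D$ such that $\operatorname{Zar}(D)\setminus\{V\}$ is compact.
   Context: For an integral domain $D$ with quotient field $K$, $\operatorname{Zar}(D)$ is the set of all valuation rings $V$ with $D\subseteq V\subseteq K$ and quotient field $K$ (including $K$ itself), called valuation overrings of $D$. It carries the Zariski topology, having as a subbasis of open sets the sets $\{V\in\operatorname{Zar}(D)\mid x_1,\ldots,x_n\in V\}$ for finite subsets $\{x_1,\ldots,x_n\}\subseteq K$. A minimal valuation overring is a minimal element of $\operatorname{Zar}(D)$ with respect to inclusion. "Compact" means that every open cover has a finite subcover (no Hausdorff condition). For $V\in\operatorname{Zar}(D)$ with maximal ideal $\mathfrak{m}_V$, let $V(X):=V[X]_{\mathfrak{m}_V[X]}\subseteq K(X)$, where $X$ is an indeterminate. For nonempty $\Delta\subseteq\operatorname{Zar}(D)$, the Kronecker function ring of $D$ with respect to $\Delta$ is $\operatorname{Kr}(D,\Delta):=\bigcap\{V(X)\mid V\in\Delta\}$. $\mathcal{K}(D)$ denotes the set of all Kronecker function rings $T$ of $D$ (rings of the form $T=\operatorname{Kr}(D,\Delta)$) such that $T\cap K=D$. *)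

theory Defs
  imports "HOL-Analysis.Abstract_Topology" "HOL-Computational_Algebra.Polynomial_Factorial"
begin

section \<open>Subrings of a field\<close>

text \<open>
  An integral domain with quotient field \<open>K\<close> is represented as a subring \<open>D\<close> of a field type
  (playing the role of \<open>K\<close>) such that \<open>quotient_field D = UNIV\<close>.
\<close>

definition is_subring :: "'k::field set \<Rightarrow> bool" where
  "is_subring R \<longleftrightarrow>
     0 \<in> R \<and> 1 \<in> R \<and> (\<forall>x\<in>R. \<forall>y\<in>R. x - y \<in> R) \<and> (\<forall>x\<in>R. \<forall>y\<in>R. x * y \<in> R)"

definition quotient_field :: "'k::field set \<Rightarrow> 'k set" where
  "quotient_field R = {a / b | a b. a \<in> R \<and> b \<in> R \<and> b \<noteq> 0}"

definition is_ideal :: "'k::field set \<Rightarrow> 'k set \<Rightarrow> bool" where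
  "is_ideal I R \<longleftrightarrow>
     I \<subseteq> R \<and> 0 \<in> I \<and> (\<forall>x\<in>I. \<forall>y\<in>I. x + y \<in> I) \<and> (\<forall>r\<in>R. \<forall>x\<in>I. r * x \<in> I)"

definition is_maximal_ideal :: "'k::field set \<Rightarrow> 'k set \<Rightarrow> bool" where
  "is_maximal_ideal M R \<longleftrightarrow>
     is_ideal M R \<and> M \<noteq> R \<and> (\<forall>J. is_ideal J R \<longrightarrow> M \<subseteq> J \<longrightarrow> J = M \<or> J = R)"

text \<open>Only meaningful when \<open>R\<close> is local; see \<open>max_ideal_valuation_ring\<close> below.\<close>

definition max_ideal :: "'k::field set \<Rightarrow> 'k set" where
  "max_ideal R = (THE M. is_maximal_ideal M R)"

definition localization :: "'k::field set \<Rightarrow> 'k set \<Rightarrow> 'k set" where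
  "localization R P = {a / b | a b. a \<in> R \<and> b \<in> R \<and> b \<notin> P}"

text \<open>\<open>A[X]\<close> as a set of polynomials over the ambient field.\<close>

definition polys_over :: "'k::field set \<Rightarrow> 'k poly set" where
  "polys_over A = {p. \<forall>i. coeff p i \<in> A}"

definition integral_over :: "'k::field \<Rightarrow> 'k set \<Rightarrow> bool" where
  "integral_over x R \<longleftrightarrow> (\<exists>p\<in>polys_over R. lead_coeff p = 1 \<and> poly p x = 0)"

definition integrally_closed :: "'k::field set \<Rightarrow> bool" where
  "integrally_closed R \<longleftrightarrow> (\<forall>x\<in>quotient_field R. integral_over x R \<longrightarrow> x \<in> R)"

section \<open>Valuation overrings and the Zariski topology\<close>

definition valuation_ring :: "'k::field set \<Rightarrow> bool" where
  "valuation_ring V \<longleftrightarrow>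
     is_subring V \<and> (\<forall>x\<in>quotient_field V. x \<noteq> 0 \<longrightarrow> x \<in> V \<or> inverse x \<in> V)"

definition Zar :: "'k::field set \<Rightarrow> 'k set set" where
  "Zar D = {V. valuation_ring V \<and> D \<subseteq> V \<and> quotient_field V = quotient_field D}"

definition zariski_topology :: "'k::field set \<Rightarrow> 'k set topology" where
  "zariski_topology D =
     topology_generated_by {{V \<in> Zar D. F \<subseteq> V} | F. finite F \<and> F \<subseteq> quotient_field D}"

definition minimal_valuation_overring :: "'k::field set \<Rightarrow> 'k set \<Rightarrow> bool" where
  "minimal_valuation_overring V D \<longleftrightarrow> V \<in> Zar D \<and> (\<forall>W\<in>Zar D. W \<subseteq> V \<longrightarrow> W = V)"

section \<open>Kronecker function rings\<close>

text \<open>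
  The type \<^typ>\<open>'k poly fract\<close> is the rational function field \<open>K(X)\<close>, and \<open>K\<close> is embedded
  in it by \<open>const_fract\<close>. The ring written \<open>V(X)\<close>, i.e. \<open>V[X]\<close> localized at \<open>\<mm>\<^sub>V[X]\<close>, is
  \<open>trivial_extension V\<close>. Since \<open>Kr(D,\<Delta>)\<close> depends on \<open>D\<close> only through \<open>\<Delta> \<subseteq> Zar D\<close>, it is
  rendered as \<open>Kr \<Delta>\<close>.
\<close>

definition const_fract :: "'k::field \<Rightarrow> 'k poly fract" where
  "const_fract x = to_fract [:x:]"

definition trivial_extension :: "'k::field set \<Rightarrow> 'k poly fract set" where
  "trivial_extension V =
     localization (to_fract ` polys_over V) (to_fract ` polys_over (max_ideal V))"

definition Kr :: "'k::field set set \<Rightarrow> 'k poly fract set" where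
  "Kr \<Delta> = (\<Inter>V\<in>\<Delta>. trivial_extension V)"

definition Kronecker_function_rings :: "'k::field set \<Rightarrow> 'k poly fract set set" where
  "Kronecker_function_rings D =
     {T. (\<exists>\<Delta>. \<Delta> \<noteq> {} \<and> \<Delta> \<subseteq> Zar D \<and> T = Kr \<Delta>) \<and>
         T \<inter> const_fract ` quotient_field D = const_fract ` D}"

section \<open>Consistency of the definitions\<close>

lemma topspace_zariski_topology: "topspace (zariski_topology D) = Zar D"
  unfolding zariski_topology_def topology_generated_by_topspace by blast

lemma max_ideal_valuation_ring:
  assumes V: "valuation_ring V"
  shows "is_maximal_ideal (max_ideal V) V"
    and "max_ideal V = {x \<in> V. \<forall>y\<in>V. x * y \<noteq> 1}"
proof -
  let ?N = "{x \<in> V. \<forall>y\<in>V. x * y \<noteq> 1}"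
  have 0: "0 \<in> V" and 1: "1 \<in> V" and mult: "\<And>x y. x \<in> V \<Longrightarrow> y \<in> V \<Longrightarrow> x * y \<in> V"
    and diff: "\<And>x y. x \<in> V \<Longrightarrow> y \<in> V \<Longrightarrow> x - y \<in> V"
    and val: "\<And>x. x \<in> quotient_field V \<Longrightarrow> x \<noteq> 0 \<Longrightarrow> x \<in> V \<or> inverse x \<in> V"
    using V unfolding valuation_ring_def is_subring_def by auto
  have add: "x + y \<in> V" if "x \<in> V" "y \<in> V" for x y
    using diff[OF that(1) diff[OF 0 that(2)]] by simp
  have absorb: "r * x \<in> ?N" if "r \<in> V" "x \<in> ?N" for r x
  proof -
    have "r * x * y \<noteq> 1" if y: "y \<in> V" for y
    proof -
      have "x * (r * y) \<noteq> 1" using \<open>x \<in> ?N\<close> mult[OF \<open>r \<in> V\<close> y] by blast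
      then show ?thesis by (simp add: mult.commute mult.left_commute)
    qed
    moreover have "r * x \<in> V" using that mult by simp
    ultimately show ?thesis by simp
  qed
  have add_N: "x + y \<in> ?N" if x: "x \<in> ?N" and y: "y \<in> ?N" for x y
  proof (cases "x = 0 \<or> y = 0")
    case True
    then show ?thesis using x y by auto
  next
    case False
    then have xy: "x \<noteq> 0" "y \<noteq> 0" by auto
    have "x / y \<in> quotient_field V"
      using x y xy unfolding quotient_field_def by blast
    then consider "x / y \<in> V" | "y / x \<in> V"
      using val[of "x / y"] xy by auto
    then show ?thesis
    proof cases
      case 1
      have "(x / y + 1) * y \<in> ?N" by (rule absorb[OF add[OF 1 \<open>1 \<in> V\<close>] y])
      moreover have "(x / y + 1) * y = x + y" using xy by (simp add: field_simps)
      ultimately show ?thesis by simp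
    next
      case 2
      have "(1 + y / x) * x \<in> ?N" by (rule absorb[OF add[OF \<open>1 \<in> V\<close> 2] x])
      moreover have "(1 + y / x) * x = x + y" using xy by (simp add: field_simps)
      ultimately show ?thesis by simp
    qed
  qed
  have ideal: "is_ideal ?N V"
    unfolding is_ideal_def
  proof (intro conjI ballI)
    show "?N \<subseteq> V" by simp
    show "0 \<in> ?N" using 0 by simp
  qed (fact add_N, fact absorb)
  have "1 \<notin> ?N" using 1 by auto
  then have proper: "?N \<noteq> V" using 1 by blast
  have sub: "J \<subseteq> ?N" if J: "is_ideal J V" "J \<noteq> V" for J
  proof
    fix x assume x: "x \<in> J"
    show "x \<in> ?N"
    proof (rule ccontr)
      assume "x \<notin> ?N"
      then obtain y where y: "y \<in> V" "x * y = 1" using x J unfolding is_ideal_def by blast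
      then have "y * x \<in> J" using x J unfolding is_ideal_def by blast
      then have "1 \<in> J" using y by (simp add: mult.commute)
      then have "V \<subseteq> J" using J unfolding is_ideal_def by (metis mult.right_neutral subsetI)
      then show False using J unfolding is_ideal_def by blast
    qed
  qed
  have max: "is_maximal_ideal ?N V"
    unfolding is_maximal_ideal_def
  proof (intro conjI allI impI)
    show "is_ideal ?N V" "?N \<noteq> V" by (fact ideal, fact proper)
    show "J = ?N \<or> J = V" if "is_ideal J V" "?N \<subseteq> J" for J
    proof (cases "J = V")
      case False
      have "J = ?N" by (rule subset_antisym[OF sub[OF that(1) False] that(2)])
      then show ?thesis by (rule disjI1)
    qed (rule disjI2)
  qed
  have uniq: "M = ?N" if "is_maximal_ideal M V" for M
  proof -
    have "is_ideal M V" "M \<noteq> V" using that unfolding is_maximal_ideal_def by simp_all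
    then have "M \<subseteq> ?N" by (rule sub)
    moreover have "\<forall>J. is_ideal J V \<longrightarrow> M \<subseteq> J \<longrightarrow> J = M \<or> J = V"
      using that unfolding is_maximal_ideal_def by (elim conjE)
    ultimately have "?N = M \<or> ?N = V" using ideal by (elim allE[of _ ?N]) (rule mp[OF mp])
    then show ?thesis using proper by (elim disjE) (rule sym, assumption, rule notE)
  qed
  show eq: "max_ideal V = ?N"
    unfolding max_ideal_def using max uniq by (rule the_equality)
  show "is_maximal_ideal (max_ideal V) V" unfolding eq by (rule max)
qed

end

theory Submission
  imports Defs
begin

text \<open>
  A Kronecker function ring \<open>T\<close> is determined by the set \<open>C(T)\<close> of all \<open>V \<in> Zar D\<close> with
  \<open>T \<subseteq> V(X)\<close>, since \<open>T = Kr (C(T))\<close>. The smallest one is \<open>A = Kr (Zar D)\<close>. If \<open>T\<close> contracts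
  to \<open>D\<close>, then so does \<open>T \<inter> V(X)\<close> for every \<open>V \<in> Zar D\<close>. As there are finitely many rings in
  \<open>\<K>(D)\<close>, and more than one, some \<open>T \<noteq> A\<close> among them is minimal; minimality says that
  \<open>T \<inter> V(X) = A\<close> for every \<open>V\<close> outside \<open>C(T)\<close>. Hence for such \<open>V\<close> every \<open>W(X)\<close> contains
  \<open>T \<inter> V(X)\<close>, and this forces \<open>T \<subseteq> W(X)\<close> or \<open>V \<subseteq> W\<close>. Two valuation rings outside \<open>C(T)\<close> thus
  contain each other, so \<open>C(T) = Zar D - {V}\<close> for a single \<open>V\<close>; and \<open>V\<close> is minimal because
  \<open>C(T)\<close> is closed under passing to larger valuation rings.

  Two facts about \<open>K(X)\<close> carry this argument. Both rest on the observation that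
  \<open>g + X\<^sup>n f\<close> with \<open>n > deg g\<close> has as its coefficients those of \<open>f\<close> together with those of \<open>g\<close>, so
  that its Gauss value is the smaller of the two values for every valuation simultaneously.

  The first fact (\<open>generic_harmonic_sum\<close>) gives, for \<open>\<alpha>\<close> and \<open>\<beta>\<close>, one element \<open>\<gamma>\<close> whose value is
  everywhere the larger of the values of \<open>\<alpha>\<close> and \<open>\<beta>\<close>. With \<open>\<alpha> \<in> T\<close> and \<open>\<beta> \<in> V\<close> that both avoid
  \<open>W(X)\<close> it yields an element of \<open>T \<inter> V(X)\<close> outside \<open>W(X)\<close>.

  The second fact (\<open>compactin_Kronecker\<close>) is the compactness of \<open>C(T)\<close>. It holds because \<open>C(T)\<close>
  behaves like the prime spectrum of \<open>T\<close>: the localization of \<open>T\<close> at a prime is a valuation ring,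
  and its contraction to \<open>K\<close> is a member of \<open>C(T)\<close> (\<open>prime_ideal_center\<close>), and the condition \<open>F \<subseteq> V\<close> for a
  finite set \<open>F\<close> says that one element of \<open>T\<close> is a unit of \<open>V(X)\<close>, namely \<open>1/p\<close> for a polynomial
  \<open>p\<close> with coefficients \<open>1\<close> and \<open>F\<close>. So compactness is the usual argument with a proper ideal and a
  prime containing it (\<open>finite_subcover_Kronecker\<close>).
\<close>

section \<open>Gauss extensions of valuations\<close>

lemma coeff_shifted_add:
  fixes p q :: "'a::comm_ring_1 poly"
  assumes "degree p < n"
  shows "coeff (p + monom 1 n * q) i = (if i < n then coeff p i else coeff q (i - n))"
  using assms by (auto simp: coeff_monom_mult coeff_eq_0)

locale field_valuation_ring =
  fixes V :: "'k::field set"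
  assumes valuation: "valuation_ring V" and quotient: "quotient_field V = UNIV"
begin

lemma zero_mem: "0 \<in> V" and one_mem: "1 \<in> V"
  and diff_mem: "x \<in> V \<Longrightarrow> y \<in> V \<Longrightarrow> x - y \<in> V"
  and mult_mem: "x \<in> V \<Longrightarrow> y \<in> V \<Longrightarrow> x * y \<in> V"
  using valuation unfolding valuation_ring_def is_subring_def by auto

lemma add_mem: "x \<in> V \<Longrightarrow> y \<in> V \<Longrightarrow> x + y \<in> V"
  using diff_mem[of x "0 - y"] diff_mem[of 0 y] zero_mem by simp

lemma sum_mem: "(\<And>i. i \<in> I \<Longrightarrow> f i \<in> V) \<Longrightarrow> sum f I \<in> V"
  by (induction I rule: infinite_finite_induct) (auto intro: zero_mem add_mem)

lemma divide_mem_trans: "y \<noteq> 0 \<Longrightarrow> x / y \<in> V \<Longrightarrow> y / z \<in> V \<Longrightarrow> x / z \<in> V"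
  using mult_mem[of "x / y" "y / z"] by simp

lemma divide_mem_linear: "x \<noteq> 0 \<Longrightarrow> y \<noteq> 0 \<Longrightarrow> x / y \<in> V \<or> y / x \<in> V"
  using valuation quotient unfolding valuation_ring_def
  by (metis UNIV_I divide_eq_0_iff inverse_divide)

lemma mem_max_ideal_iff: "x \<in> max_ideal V \<longleftrightarrow> x \<in> V \<and> (x = 0 \<or> inverse x \<notin> V)"
proof -
  have "(\<forall>y\<in>V. x * y \<noteq> 1) \<longleftrightarrow> x = 0 \<or> inverse x \<notin> V"
    by (metis inverse_unique mult_zero_left right_inverse zero_neq_one)
  then show ?thesis
    unfolding max_ideal_valuation_ring(2)[OF valuation] by blast
qed

lemma ideal_max_ideal: "is_ideal (max_ideal V) V"
  using max_ideal_valuation_ring(1)[OF valuation] unfolding is_maximal_ideal_def by blast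

text \<open>
  The coefficients of \<open>p\<close> generate the principal fractional ideal \<open>c V\<close>. Working with generators
  \<open>c\<close>, unique up to units of \<open>V\<close>, avoids the value group: \<open>c\<close> stands for the Gauss value of \<open>p\<close>.
\<close>

definition has_content :: "'k poly \<Rightarrow> 'k \<Rightarrow> bool" where
  "has_content p c \<longleftrightarrow>
     c \<noteq> 0 \<and> (\<forall>i. coeff p i / c \<in> V) \<and> (\<exists>i. coeff p i \<noteq> 0 \<and> c / coeff p i \<in> V)"

lemma has_content_nonzero: "has_content p c \<Longrightarrow> c \<noteq> 0 \<and> p \<noteq> 0"
  unfolding has_content_def by auto

text \<open>
  Divisibility with respect to \<open>V\<close> is total, so some nonzero coefficient divides all others.
\<close>

lemma has_content_exists:
  assumes "p \<noteq> 0"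
  obtains c where "has_content p c"
proof -
  have "\<exists>j\<in>I. coeff p j \<noteq> 0 \<and> (\<forall>i\<in>I. coeff p i / coeff p j \<in> V)"
    if "finite I" "\<exists>i\<in>I. coeff p i \<noteq> 0" for I
    using that
  proof (induction I rule: finite_induct)
    case (insert k I)
    show ?case
    proof (cases "\<exists>i\<in>I. coeff p i \<noteq> 0")
      case False
      then show ?thesis using insert.prems zero_mem one_mem by (auto intro!: bexI[of _ k])
    next
      case True
      then obtain j where j: "j \<in> I" "coeff p j \<noteq> 0" "\<And>i. i \<in> I \<Longrightarrow> coeff p i / coeff p j \<in> V"
        using insert.IH by blast
      show ?thesis
      proof (cases "coeff p k / coeff p j \<in> V")
        case True
        then show ?thesis using j by auto
      next
        case False
        then have k: "coeff p k \<noteq> 0" using zero_mem by auto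
        then have "coeff p j / coeff p k \<in> V" using divide_mem_linear[OF k j(2)] False by blast
        then have "\<And>i. i \<in> I \<Longrightarrow> coeff p i / coeff p k \<in> V"
          using divide_mem_trans[OF j(2) j(3)] by blast
        then show ?thesis using k one_mem by (auto intro!: bexI[of _ k])
      qed
    qed
  qed simp
  from this[of "{..degree p}"] assms obtain j
    where j: "coeff p j \<noteq> 0" "\<And>i. i \<le> degree p \<Longrightarrow> coeff p i / coeff p j \<in> V"
    by (force simp: leading_coeff_neq_0)
  have "coeff p i / coeff p j \<in> V" for i
    using j(2)[of i] zero_mem by (cases "i \<le> degree p") (auto simp: coeff_eq_0)
  then have "has_content p (coeff p j)"
    unfolding has_content_def using j(1) one_mem by auto
  then show thesis by (rule that)
qed

lemma has_content_unique:
  assumes "has_content p c" "has_content p d"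
  shows "c / d \<in> V"
  using assms divide_mem_trans unfolding has_content_def by blast

lemma has_content_one_iff:
  "has_content p 1 \<longleftrightarrow> p \<in> polys_over V \<and> p \<notin> polys_over (max_ideal V)"
  unfolding has_content_def polys_over_def mem_max_ideal_iff
  by (auto simp: inverse_eq_divide)

lemma has_content_smult_iff:
  assumes "a \<noteq> 0"
  shows "has_content (smult a p) (a * c) \<longleftrightarrow> has_content p c"
  using assms unfolding has_content_def by auto

text \<open>
  Gauss's lemma: at the sum of the least indices at which \<open>p\<close> and \<open>q\<close> have unit coefficients, all
  terms of the product coefficient but one lie in the maximal ideal.
\<close>

lemma has_content_one_mult:
  assumes p: "has_content p 1" and q: "has_content q 1"
  shows "has_content (p * q) 1"
proof -
  let ?m = "max_ideal V"
  have pV: "\<And>i. coeff p i \<in> V" and qV: "\<And>i. coeff q i \<in> V"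
    using p q unfolding has_content_def by auto
  have m_add: "x + y \<in> ?m" if "x \<in> ?m" "y \<in> ?m" for x y
    using that ideal_max_ideal unfolding is_ideal_def by blast
  have m_mult: "x * y \<in> ?m" if "x \<in> V" "y \<in> ?m" for x y
    using that ideal_max_ideal unfolding is_ideal_def by blast
  have m0: "0 \<in> ?m" using ideal_max_ideal unfolding is_ideal_def by blast
  have m_sum: "sum f I \<in> ?m" if "\<And>i. i \<in> I \<Longrightarrow> f i \<in> ?m" for f and I :: "nat set"
    using that by (induction I rule: infinite_finite_induct) (auto intro: m0 m_add)
  have exi: "\<exists>i. coeff p i \<notin> ?m" and exj: "\<exists>j. coeff q j \<notin> ?m"
    using p q unfolding has_content_one_iff polys_over_def by auto
  define i where "i = (LEAST i. coeff p i \<notin> ?m)"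
  define j where "j = (LEAST j. coeff q j \<notin> ?m)"
  have i: "coeff p i \<notin> ?m" "\<And>k. k < i \<Longrightarrow> coeff p k \<in> ?m"
    using LeastI_ex[OF exi] not_less_Least unfolding i_def by blast+
  have j: "coeff q j \<notin> ?m" "\<And>k. k < j \<Longrightarrow> coeff q k \<in> ?m"
    using LeastI_ex[OF exj] not_less_Least unfolding j_def by blast+
  define r where "r = (\<Sum>k\<in>{..i + j} - {i}. coeff p k * coeff q (i + j - k))"
  have r: "r \<in> ?m"
    unfolding r_def
  proof (rule m_sum)
    fix k assume k: "k \<in> {..i + j} - {i}"
    show "coeff p k * coeff q (i + j - k) \<in> ?m"
    proof (cases "k < i")
      case True
      then show ?thesis using m_mult[OF qV i(2)] by (simp add: mult.commute)
    next
      case False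
      then have "i + j - k < j" using k by auto
      then show ?thesis using m_mult[OF pV j(2)] by blast
    qed
  qed
  have "coeff (p * q) (i + j) = coeff p i * coeff q j + r"
    unfolding coeff_mult r_def by (subst sum.remove[of _ i]) auto
  moreover have "coeff p i * coeff q j \<notin> ?m"
    using i(1) j(1) pV[of i] qV[of j] mult_mem[of "inverse (coeff p i)" "inverse (coeff q j)"]
    unfolding mem_max_ideal_iff by auto
  moreover have "coeff p i * coeff q j = (coeff p i * coeff q j + r) + (-1) * r" by simp
  moreover have "-1 \<in> V" using diff_mem[OF zero_mem one_mem] by simp
  ultimately have "coeff (p * q) (i + j) \<notin> ?m"
    using m_add m_mult r by metis
  moreover have "coeff (p * q) n \<in> V" for n
    unfolding coeff_mult by (intro sum_mem mult_mem pV qV)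
  ultimately show ?thesis unfolding has_content_one_iff polys_over_def by auto
qed

lemma has_content_mult:
  assumes "has_content p c" "has_content q d"
  shows "has_content (p * q) (c * d)"
proof -
  have nz: "c \<noteq> 0" "d \<noteq> 0" using assms has_content_nonzero by auto
  have "has_content (smult (1 / c) p) 1" "has_content (smult (1 / d) q) 1"
    using assms has_content_smult_iff[of "1 / c" p c] has_content_smult_iff[of "1 / d" q d] nz
    by auto
  then have "has_content (smult (1 / c) p * smult (1 / d) q) 1" by (rule has_content_one_mult)
  then have "has_content (smult (1 / (c * d)) (p * q)) (1 / (c * d) * (c * d))"
    using nz by (simp add: mult.commute)
  moreover have "1 / (c * d) \<noteq> 0" using nz by simp
  ultimately show ?thesis using has_content_smult_iff by blast
qed

lemma has_content_monom: "has_content (monom 1 n) 1"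
  unfolding has_content_def using zero_mem one_mem by (intro conjI allI exI[of _ n]) auto

lemma has_content_const: "x \<noteq> 0 \<Longrightarrow> has_content [:x:] x"
  unfolding has_content_def using zero_mem one_mem
  by (intro conjI allI exI[of _ 0]) (auto simp: coeff_pCons split: nat.splits)

text \<open>
  The shift by \<open>n\<close> prevents cancellation, so the content of the sum is generated by whichever of the
  two contents divides the other. The same polynomial works for all \<open>V\<close> at once, which is what makes
  it possible to produce elements of intersections of the rings \<open>V(X)\<close>.
\<close>

lemma has_content_shifted_add:
  assumes p: "has_content p c" and q: "has_content q d" and n: "degree p < n"
  shows "d / c \<in> V \<Longrightarrow> has_content (p + monom 1 n * q) c"
    and "c / d \<in> V \<Longrightarrow> has_content (p + monom 1 n * q) d"
proof -
  note coeff = coeff_shifted_add[OF n]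
  have nz: "c \<noteq> 0" "d \<noteq> 0" using p q has_content_nonzero by auto
  have p': "\<And>i. coeff p i / c \<in> V" and q': "\<And>i. coeff q i / d \<in> V"
    using p q unfolding has_content_def by auto
  obtain i where i: "coeff p i \<noteq> 0" "c / coeff p i \<in> V"
    using p unfolding has_content_def by auto
  obtain j where j: "coeff q j \<noteq> 0" "d / coeff q j \<in> V"
    using q unfolding has_content_def by auto
  have "i < n" using i(1) n by (meson le_degree le_less_trans)
  then have i': "coeff (p + monom 1 n * q) i = coeff p i" unfolding coeff by simp
  have j': "coeff (p + monom 1 n * q) (n + j) = coeff q j" unfolding coeff by simp
  show "has_content (p + monom 1 n * q) c" if "d / c \<in> V"
  proof -
    have "coeff q k / c \<in> V" for k using divide_mem_trans[OF nz(2) q' that] .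
    then have "coeff (p + monom 1 n * q) k / c \<in> V" for k unfolding coeff using p' by simp
    moreover have "\<exists>k. coeff (p + monom 1 n * q) k \<noteq> 0 \<and> c / coeff (p + monom 1 n * q) k \<in> V"
      by (rule exI[of _ i]) (use i i' in simp)
    ultimately show ?thesis using nz unfolding has_content_def by blast
  qed
  show "has_content (p + monom 1 n * q) d" if "c / d \<in> V"
  proof -
    have "coeff p k / d \<in> V" for k using divide_mem_trans[OF nz(1) p' that] .
    then have "coeff (p + monom 1 n * q) k / d \<in> V" for k unfolding coeff using q' by simp
    moreover have "\<exists>k. coeff (p + monom 1 n * q) k \<noteq> 0 \<and> d / coeff (p + monom 1 n * q) k \<in> V"
      by (rule exI[of _ "n + j"]) (use j j' in simp)
    ultimately show ?thesis using nz unfolding has_content_def by blast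
  qed
qed

lemma mem_trivial_extension_iff:
  "\<theta> \<in> trivial_extension V \<longleftrightarrow>
     (\<exists>a b. \<theta> = to_fract a / to_fract b \<and> a \<in> polys_over V \<and> has_content b 1)"
proof -
  have "to_fract b \<in> to_fract ` A \<longleftrightarrow> b \<in> A" for b :: "'k poly" and A by auto
  then show ?thesis
    unfolding trivial_extension_def localization_def has_content_one_iff by blast
qed

text \<open>
  \<open>V(X)\<close> is the valuation ring of the Gauss extension. In the forward direction, multiplicativity of
  contents compares \<open>c\<close> with \<open>e d\<close>, where \<open>e\<close> is the content of an integral numerator.
\<close>

lemma quotient_mem_trivial_extension_iff:
  assumes p: "has_content p c" and q: "has_content q d"
  shows "to_fract p / to_fract q \<in> trivial_extension V \<longleftrightarrow> c / d \<in> V"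
proof
  have nz: "c \<noteq> 0" "d \<noteq> 0" "p \<noteq> 0" "q \<noteq> 0" using p q has_content_nonzero by auto
  have cross: "to_fract p / to_fract q = to_fract a / to_fract b \<longleftrightarrow> p * b = a * q"
    if "b \<noteq> 0" for a b
    using that nz by (simp add: frac_eq_eq flip: to_fract_mult)
  {
    assume cd: "c / d \<in> V"
    have "to_fract p / to_fract q = to_fract (smult (1 / d) p) / to_fract (smult (1 / d) q)"
      using nz by (subst cross) auto
    moreover have "smult (1 / d) p \<in> polys_over V"
      using p divide_mem_trans[OF nz(1) _ cd] unfolding polys_over_def has_content_def by simp
    moreover have "has_content (smult (1 / d) q) 1"
      using q has_content_smult_iff[of "1 / d" q d] nz by simp
    ultimately show "to_fract p / to_fract q \<in> trivial_extension V"
      unfolding mem_trivial_extension_iff by blast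
  next
    assume "to_fract p / to_fract q \<in> trivial_extension V"
    then obtain a b where ab: "to_fract p / to_fract q = to_fract a / to_fract b"
        "a \<in> polys_over V" "has_content b 1"
      unfolding mem_trivial_extension_iff by blast
    have eq: "p * b = a * q" using cross ab has_content_nonzero by blast
    then have "a \<noteq> 0" using nz ab(3) has_content_nonzero by auto
    then obtain e where e: "has_content a e" by (rule has_content_exists)
    then obtain i where i: "coeff a i \<noteq> 0" "e / coeff a i \<in> V"
      unfolding has_content_def by blast
    have "coeff a i \<in> V" using ab(2) unfolding polys_over_def by blast
    then have "e \<in> V" using mult_mem[OF i(2)] i(1) by fastforce
    moreover have "has_content (p * b) c" "has_content (p * b) (e * d)"
      using has_content_mult[OF p ab(3)] has_content_mult[OF e q] eq by auto
    then have "c / (e * d) \<in> V" by (rule has_content_unique)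
    ultimately have "e * (c / (e * d)) \<in> V" by (rule mult_mem)
    then show "c / d \<in> V" using has_content_nonzero[OF e] by simp
  }
qed

lemma trivial_extension_subring: "is_subring (trivial_extension V)"
  unfolding is_subring_def
proof (intro conjI ballI)
  have one: "has_content 1 1" using has_content_const[of 1] by (simp flip: one_pCons)
  have polys: "0 \<in> polys_over V" "1 \<in> polys_over V"
    using zero_mem one_mem unfolding polys_over_def by (auto simp: coeff_1)
  show "0 \<in> trivial_extension V"
    unfolding mem_trivial_extension_iff by (rule exI[of _ 0], rule exI[of _ 1]) (simp add: one polys)
  show "1 \<in> trivial_extension V"
    unfolding mem_trivial_extension_iff by (rule exI[of _ 1], rule exI[of _ 1]) (simp add: one polys)
  have polys_diff: "a - b \<in> polys_over V" if "a \<in> polys_over V" "b \<in> polys_over V" for a b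
    using that diff_mem unfolding polys_over_def by simp
  have polys_mult: "a * b \<in> polys_over V" if "a \<in> polys_over V" "b \<in> polys_over V" for a b
    using that unfolding polys_over_def by (auto simp: coeff_mult intro!: sum_mem mult_mem)
  fix x y assume "x \<in> trivial_extension V" "y \<in> trivial_extension V"
  then obtain a b a' b' where x: "x = to_fract a / to_fract b" "a \<in> polys_over V" "has_content b 1"
    and y: "y = to_fract a' / to_fract b'" "a' \<in> polys_over V" "has_content b' 1"
    unfolding mem_trivial_extension_iff by metis
  have nz: "b \<noteq> 0" "b' \<noteq> 0" using x y has_content_nonzero by auto
  have bb': "has_content (b * b') 1" using x y has_content_mult by fastforce
  have b: "b \<in> polys_over V" "b' \<in> polys_over V" using x y has_content_one_iff by auto
  have "x - y = to_fract (a * b' - a' * b) / to_fract (b * b')"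
    using nz unfolding x(1) y(1) by (simp add: diff_frac_eq)
  moreover have "a * b' - a' * b \<in> polys_over V" using polys_diff polys_mult x y b by blast
  ultimately show "x - y \<in> trivial_extension V"
    using bb' unfolding mem_trivial_extension_iff by blast
  have "x * y = to_fract (a * a') / to_fract (b * b')" unfolding x(1) y(1) by simp
  moreover have "a * a' \<in> polys_over V" using polys_mult x y by blast
  ultimately show "x * y \<in> trivial_extension V"
    using bb' unfolding mem_trivial_extension_iff by blast
qed

lemma trivial_extension_valuation_ring: "valuation_ring (trivial_extension V)"
  unfolding valuation_ring_def
proof (intro conjI ballI impI)
  fix \<theta> :: "'k poly fract" assume "\<theta> \<noteq> 0"
  obtain f g where \<theta>: "\<theta> = to_fract f / to_fract g" "g \<noteq> 0"
    by (cases \<theta>) (auto simp: Fract_conv_to_fract)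
  then have "f \<noteq> 0" using \<open>\<theta> \<noteq> 0\<close> by auto
  then obtain c where c: "has_content f c" by (rule has_content_exists)
  obtain d where d: "has_content g d" using \<theta>(2) by (rule has_content_exists)
  show "\<theta> \<in> trivial_extension V \<or> inverse \<theta> \<in> trivial_extension V"
    using divide_mem_linear[of c d] has_content_nonzero[OF c] has_content_nonzero[OF d]
      quotient_mem_trivial_extension_iff[OF c d] quotient_mem_trivial_extension_iff[OF d c]
    unfolding \<theta>(1) by auto
qed (fact trivial_extension_subring)

lemma const_fract_mem_trivial_extension_iff: "const_fract x \<in> trivial_extension V \<longleftrightarrow> x \<in> V"
proof (cases "x = 0")
  case True
  then show ?thesis
    using trivial_extension_subring zero_mem unfolding is_subring_def const_fract_def by simp
next
  case False
  from quotient_mem_trivial_extension_iff[OF has_content_const[OF this] has_content_const[of 1]]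
  show ?thesis unfolding const_fract_def by (simp flip: one_pCons)
qed

end

lemma field_valuation_ring_Zar:
  assumes "V \<in> Zar D" "quotient_field D = UNIV"
  shows "field_valuation_ring V"
  using assms unfolding Zar_def by unfold_locales auto

lemma trivial_extension_mono:
  assumes W: "field_valuation_ring W" and V: "field_valuation_ring V" and "W \<subseteq> V"
  shows "trivial_extension W \<subseteq> trivial_extension V"
proof
  interpret W: field_valuation_ring W by (fact W)
  interpret V: field_valuation_ring V by (fact V)
  have content: "V.has_content p c" if "W.has_content p c" for p c
    using that \<open>W \<subseteq> V\<close> unfolding W.has_content_def V.has_content_def by blast
  fix \<theta> assume "\<theta> \<in> trivial_extension W"
  then obtain a b where "\<theta> = to_fract a / to_fract b" "a \<in> polys_over W" "W.has_content b 1"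
    unfolding W.mem_trivial_extension_iff by blast
  moreover from this have "a \<in> polys_over V" using \<open>W \<subseteq> V\<close> unfolding polys_over_def by blast
  ultimately show "\<theta> \<in> trivial_extension V"
    unfolding V.mem_trivial_extension_iff using content by blast
qed

lemma fract_quotient_cases:
  fixes \<theta> :: "'k::field poly fract"
  assumes "\<theta> \<noteq> 0"
  obtains f g where "\<theta> = to_fract f / to_fract g" "f \<noteq> 0" "g \<noteq> 0"
  using assms by (cases \<theta>) (auto simp: Fract_conv_to_fract)

section \<open>Kronecker function rings\<close>

lemma Kr_subring:
  assumes "\<Delta> \<subseteq> Zar D" "quotient_field D = UNIV"
  shows "is_subring (Kr \<Delta>)"
proof -
  have "is_subring (trivial_extension V)" if "V \<in> \<Delta>" for V
    using field_valuation_ring.trivial_extension_subring[OF field_valuation_ring_Zar[OF _ assms(2)]]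
      assms(1) that by blast
  then show ?thesis unfolding Kr_def is_subring_def by simp
qed

lemma monom_mem_Kr_Zar:
  assumes "quotient_field D = UNIV"
  shows "to_fract (monom 1 n) \<in> Kr (Zar D)"
  unfolding Kr_def
proof
  fix V assume "V \<in> Zar D"
  then interpret field_valuation_ring V using assms by (rule field_valuation_ring_Zar)
  from quotient_mem_trivial_extension_iff[OF has_content_monom[of n] has_content_const[of 1]]
  show "to_fract (monom 1 n) \<in> trivial_extension V" using one_mem by (simp flip: one_pCons)
qed

text \<open>
  A polynomial divides each of its own coefficients in every \<open>V(X)\<close>. This is the source of inverses
  in \<open>Kr (Zar D)\<close>: a polynomial with a coefficient that is a unit becomes a unit itself.
\<close>

lemma coeff_quotient_mem_Kr_Zar:
  assumes "quotient_field D = UNIV" "p \<noteq> 0"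
  shows "const_fract (coeff p i) / to_fract p \<in> Kr (Zar D)"
  unfolding Kr_def
proof
  fix V assume "V \<in> Zar D"
  then interpret field_valuation_ring V using assms(1) by (rule field_valuation_ring_Zar)
  obtain c where c: "has_content p c" using assms(2) by (rule has_content_exists)
  show "const_fract (coeff p i) / to_fract p \<in> trivial_extension V"
  proof (cases "coeff p i = 0")
    case True
    then show ?thesis
      using trivial_extension_subring unfolding is_subring_def const_fract_def by simp
  next
    case False
    have "coeff p i / c \<in> V" using c unfolding has_content_def by blast
    then show ?thesis
      using quotient_mem_trivial_extension_iff[OF has_content_const[OF False] c]
      unfolding const_fract_def by simp
  qed
qed

lemma quotient_shifted_add_mem_Kr_Zar:
  assumes D: "quotient_field D = UNIV" and nz: "f \<noteq> 0" "g \<noteq> 0" and n: "degree g < n"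
  shows "to_fract f / to_fract (g + monom 1 n * f) \<in> Kr (Zar D)"
    and "to_fract g / to_fract (g + monom 1 n * f) \<in> Kr (Zar D)"
proof -
  have "to_fract f / to_fract (g + monom 1 n * f) \<in> trivial_extension V \<and>
        to_fract g / to_fract (g + monom 1 n * f) \<in> trivial_extension V" if "V \<in> Zar D" for V
  proof -
    interpret field_valuation_ring V using that D by (rule field_valuation_ring_Zar)
    obtain c where c: "has_content f c" using nz(1) by (rule has_content_exists)
    obtain d where d: "has_content g d" using nz(2) by (rule has_content_exists)
    have cd: "c \<noteq> 0" "d \<noteq> 0" using c d has_content_nonzero by auto
    show ?thesis
    proof (cases "c / d \<in> V")
      case True
      note s = has_content_shifted_add(1)[OF d c n True]
      show ?thesis
        using quotient_mem_trivial_extension_iff[OF c s] quotient_mem_trivial_extension_iff[OF d s]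
          True cd one_mem by simp
    next
      case False
      then have dc: "d / c \<in> V" using divide_mem_linear[OF cd] by blast
      note s = has_content_shifted_add(2)[OF d c n dc]
      show ?thesis
        using quotient_mem_trivial_extension_iff[OF c s] quotient_mem_trivial_extension_iff[OF d s]
          dc cd one_mem by simp
    qed
  qed
  then show "to_fract f / to_fract (g + monom 1 n * f) \<in> Kr (Zar D)"
    and "to_fract g / to_fract (g + monom 1 n * f) \<in> Kr (Zar D)"
    unfolding Kr_def by auto
qed

text \<open>
  In terms of values, \<open>\<gamma>\<close> has the larger of the values of \<open>\<alpha>\<close> and \<open>\<beta>\<close>. Inverting turns the larger
  value into the smaller one, which a shifted sum realizes for all valuations simultaneously; so
  \<open>\<gamma> = 1 / (1/\<alpha> + X\<^sup>n/\<beta>)\<close>, with \<open>n\<close> beyond the degrees involved.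
\<close>

lemma generic_harmonic_sum:
  fixes \<alpha> \<beta> :: "'k::field poly fract"
  assumes D: "quotient_field D = UNIV" and "\<alpha> \<noteq> 0" "\<beta> \<noteq> 0"
  obtains \<gamma> where
    "\<And>V. V \<in> Zar D \<Longrightarrow>
      \<gamma> \<in> trivial_extension V \<longleftrightarrow> \<alpha> \<in> trivial_extension V \<or> \<beta> \<in> trivial_extension V"
proof -
  obtain f g where \<alpha>: "\<alpha> = to_fract f / to_fract g" "f \<noteq> 0" "g \<noteq> 0"
    using \<open>\<alpha> \<noteq> 0\<close> by (rule fract_quotient_cases)
  obtain h k where \<beta>: "\<beta> = to_fract h / to_fract k" "h \<noteq> 0" "k \<noteq> 0"
    using \<open>\<beta> \<noteq> 0\<close> by (rule fract_quotient_cases)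
  define n where "n = Suc (degree (h * g))"
  \<comment> \<open>This is \<open>\<alpha>\<beta> / (\<beta> + X\<^sup>n\<alpha>)\<close> with denominators cleared.\<close>
  define \<gamma> where "\<gamma> = to_fract (f * h) / to_fract (h * g + monom 1 n * (f * k))"
  have "\<gamma> \<in> trivial_extension V \<longleftrightarrow> \<alpha> \<in> trivial_extension V \<or> \<beta> \<in> trivial_extension V"
    if "V \<in> Zar D" for V
  proof -
    interpret field_valuation_ring V using that D by (rule field_valuation_ring_Zar)
    obtain cf where cf: "has_content f cf" using \<alpha>(2) by (rule has_content_exists)
    obtain cg where cg: "has_content g cg" using \<alpha>(3) by (rule has_content_exists)
    obtain ch where ch: "has_content h ch" using \<beta>(2) by (rule has_content_exists)
    obtain ck where ck: "has_content k ck" using \<beta>(3) by (rule has_content_exists)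
    have nz: "cf \<noteq> 0" "cg \<noteq> 0" "ch \<noteq> 0" "ck \<noteq> 0" using cf cg ch ck has_content_nonzero by auto
    note hg = has_content_mult[OF ch cg] and fk = has_content_mult[OF cf ck]
      and fh = has_content_mult[OF cf ch]
    have n: "degree (h * g) < n" by (simp add: n_def)
    have \<alpha>_iff: "\<alpha> \<in> trivial_extension V \<longleftrightarrow> cf / cg \<in> V"
      and \<beta>_iff: "\<beta> \<in> trivial_extension V \<longleftrightarrow> ch / ck \<in> V"
      unfolding \<alpha>(1) \<beta>(1)
      by (rule quotient_mem_trivial_extension_iff[OF cf cg] quotient_mem_trivial_extension_iff[OF ch ck])+
    show ?thesis
    proof (cases "(cf * ck) / (ch * cg) \<in> V")
      case True
      have "cf * ch / (ch * cg) = cf / cg" using nz by simp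
      then have "\<gamma> \<in> trivial_extension V \<longleftrightarrow> cf / cg \<in> V"
        using quotient_mem_trivial_extension_iff[OF fh has_content_shifted_add(1)[OF hg fk n True]]
        unfolding \<gamma>_def by simp
      moreover have "cf / cg \<in> V" if "ch / ck \<in> V"
        using mult_mem[OF True that] nz by simp
      ultimately show ?thesis unfolding \<alpha>_iff \<beta>_iff by blast
    next
      case False
      then have inv: "(ch * cg) / (cf * ck) \<in> V"
        using divide_mem_linear[of "cf * ck" "ch * cg"] nz by auto
      have "cf * ch / (cf * ck) = ch / ck" using nz by simp
      then have "\<gamma> \<in> trivial_extension V \<longleftrightarrow> ch / ck \<in> V"
        using quotient_mem_trivial_extension_iff[OF fh has_content_shifted_add(2)[OF hg fk n inv]]
        unfolding \<gamma>_def by simp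
      moreover have "ch / ck \<in> V" if "cf / cg \<in> V"
        using mult_mem[OF inv that] nz by simp
      ultimately show ?thesis unfolding \<alpha>_iff \<beta>_iff by blast
    qed
  qed
  then show thesis by (rule that)
qed

section \<open>Localizations at primes\<close>

definition is_prime_ideal :: "'k::field set \<Rightarrow> 'k set \<Rightarrow> bool" where
  "is_prime_ideal P R \<longleftrightarrow>
     is_ideal P R \<and> 1 \<notin> P \<and> (\<forall>x\<in>R. \<forall>y\<in>R. x * y \<in> P \<longrightarrow> x \<in> P \<or> y \<in> P)"

lemma is_subring_add: "is_subring R \<Longrightarrow> x \<in> R \<Longrightarrow> y \<in> R \<Longrightarrow> x + y \<in> R"
  unfolding is_subring_def by (metis diff_0 diff_minus_eq_add)

text \<open>
  By Zorn's lemma there is an ideal maximal among those that contain \<open>J\<close> but not \<open>1\<close>, and such an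
  ideal is prime.
\<close>

lemma prime_ideal_containing:
  assumes R: "is_subring R" and J: "is_ideal J R" "1 \<notin> J"
  obtains P where "is_prime_ideal P R" "J \<subseteq> P"
proof -
  define \<I> where "\<I> = {I. is_ideal I R \<and> 1 \<notin> I \<and> J \<subseteq> I}"
  have "\<exists>P\<in>\<I>. \<forall>I\<in>\<I>. P \<subseteq> I \<longrightarrow> I = P"
  proof (rule subset_Zorn_nonempty)
    show "\<I> \<noteq> {}" using J unfolding \<I>_def by blast
    fix \<C> assume \<C>: "\<C> \<noteq> {}" "subset.chain \<I> \<C>"
    then have I: "\<And>I. I \<in> \<C> \<Longrightarrow> is_ideal I R \<and> 1 \<notin> I \<and> J \<subseteq> I"
      and lin: "\<And>I I'. I \<in> \<C> \<Longrightarrow> I' \<in> \<C> \<Longrightarrow> I \<subseteq> I' \<or> I' \<subseteq> I"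
      unfolding subset.chain_def \<I>_def by blast+
    have "x + y \<in> \<Union>\<C>" if xy: "x \<in> \<Union>\<C>" "y \<in> \<Union>\<C>" for x y
    proof -
      obtain I I' where "I \<in> \<C>" "x \<in> I" "I' \<in> \<C>" "y \<in> I'" using xy by blast
      then obtain I'' where "I'' \<in> \<C>" "x \<in> I''" "y \<in> I''" using lin by blast
      then show ?thesis using I unfolding is_ideal_def by blast
    qed
    moreover have "\<Union>\<C> \<subseteq> R" "\<And>r x. r \<in> R \<Longrightarrow> x \<in> \<Union>\<C> \<Longrightarrow> r * x \<in> \<Union>\<C>"
      using I unfolding is_ideal_def by blast+
    moreover have "0 \<in> \<Union>\<C>" "1 \<notin> \<Union>\<C>" "J \<subseteq> \<Union>\<C>"
      using I \<C>(1) unfolding is_ideal_def by blast+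
    ultimately show "\<Union>\<C> \<in> \<I>" unfolding \<I>_def is_ideal_def by blast
  qed
  then obtain P where P: "is_ideal P R" "1 \<notin> P" "J \<subseteq> P"
    and max: "\<And>I. is_ideal I R \<Longrightarrow> 1 \<notin> I \<Longrightarrow> P \<subseteq> I \<Longrightarrow> I = P"
    unfolding \<I>_def by (smt (verit) mem_Collect_eq subset_trans)
  have rules: "0 \<in> R" "1 \<in> R" "\<And>x y. x \<in> R \<Longrightarrow> y \<in> R \<Longrightarrow> x * y \<in> R"
    using R unfolding is_subring_def by auto
  have Prules: "P \<subseteq> R" "0 \<in> P" "\<And>x y. x \<in> P \<Longrightarrow> y \<in> P \<Longrightarrow> x + y \<in> P"
    "\<And>r x. r \<in> R \<Longrightarrow> x \<in> P \<Longrightarrow> r * x \<in> P"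
    using P unfolding is_ideal_def by auto
  have "y \<in> P" if xy: "x \<in> R" "y \<in> R" "x * y \<in> P" "x \<notin> P" for x y
  proof -
    \<comment> \<open>The ideal generated by \<open>P\<close> and \<open>x\<close> is strictly larger than \<open>P\<close>, hence contains \<open>1\<close>.\<close>
    define I where "I = {p + r * x | p r. p \<in> P \<and> r \<in> R}"
    have "is_ideal I R"
      unfolding is_ideal_def
    proof (intro conjI ballI)
      show "I \<subseteq> R" unfolding I_def using Prules(1) rules xy is_subring_add[OF R] by auto
      show "0 \<in> I" unfolding I_def using Prules(2) rules(1) by force
      fix a b assume "a \<in> I" "b \<in> I"
      then obtain p r p' r' where "a = p + r * x" "b = p' + r' * x" "p \<in> P" "p' \<in> P" "r \<in> R" "r' \<in> R"
        unfolding I_def by blast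
      moreover then have "a + b = (p + p') + (r + r') * x" by (simp add: algebra_simps)
      ultimately show "a + b \<in> I" unfolding I_def using Prules(3) is_subring_add[OF R] by blast
    next
      fix s a assume "s \<in> R" "a \<in> I"
      then obtain p r where "a = p + r * x" "p \<in> P" "r \<in> R" unfolding I_def by blast
      moreover then have "s * a = s * p + (s * r) * x" by (simp add: algebra_simps)
      ultimately show "s * a \<in> I" unfolding I_def using Prules(4) rules(3) \<open>s \<in> R\<close> by blast
    qed
    moreover have "P \<subseteq> I"
    proof
      fix p assume "p \<in> P"
      moreover have "p = p + 0 * x" by simp
      ultimately show "p \<in> I" unfolding I_def using rules(1) by blast
    qed
    moreover have "x \<in> I"
    proof -
      have "x = 0 + 1 * x" by simp
      then show ?thesis unfolding I_def using Prules(2) rules(2) by blast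
    qed
    ultimately have "1 \<in> I" using max \<open>x \<notin> P\<close> by blast
    then obtain p r where pr: "1 = p + r * x" "p \<in> P" "r \<in> R" unfolding I_def by blast
    have "y = y * (p + r * x)" unfolding pr(1)[symmetric] by simp
    also have "\<dots> = y * p + r * (x * y)" by (simp add: algebra_simps)
    finally show ?thesis using Prules(3,4) pr xy by metis
  qed
  then have "is_prime_ideal P R" unfolding is_prime_ideal_def using P by blast
  then show thesis using P(3) by (rule that)
qed

lemma localization_memI: "a \<in> R \<Longrightarrow> b \<in> R \<Longrightarrow> b \<notin> P \<Longrightarrow> a / b \<in> localization R P"
  unfolding localization_def by blast

lemma localization_subring:
  assumes R: "is_subring R" and P: "is_prime_ideal P R"
  shows "is_subring (localization R P)" "R \<subseteq> localization R P"
proof -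
  have rules: "0 \<in> R" "1 \<in> R" "\<And>x y. x \<in> R \<Longrightarrow> y \<in> R \<Longrightarrow> x * y \<in> R"
    "\<And>x y. x \<in> R \<Longrightarrow> y \<in> R \<Longrightarrow> x - y \<in> R"
    using R unfolding is_subring_def by auto
  have Prules: "0 \<in> P" "1 \<notin> P" "\<And>x y. x \<in> R \<Longrightarrow> y \<in> R \<Longrightarrow> x \<notin> P \<Longrightarrow> y \<notin> P \<Longrightarrow> x * y \<notin> P"
    using P unfolding is_prime_ideal_def is_ideal_def by blast+
  show sub: "R \<subseteq> localization R P"
  proof
    fix x assume "x \<in> R"
    then show "x \<in> localization R P"
      using localization_memI[of x R 1 P] rules(2) Prules(2) by simp
  qed
  show "is_subring (localization R P)"
    unfolding is_subring_def
  proof (intro conjI ballI)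
    show "0 \<in> localization R P" "1 \<in> localization R P" using sub rules by auto
    fix x y assume "x \<in> localization R P" "y \<in> localization R P"
    then obtain a b a' b' where x: "x = a / b" "a \<in> R" "b \<in> R" "b \<notin> P"
      and y: "y = a' / b'" "a' \<in> R" "b' \<in> R" "b' \<notin> P"
      unfolding localization_def by blast
    have "b \<noteq> 0" "b' \<noteq> 0" using x y Prules(1) by auto
    then have "x - y = (a * b' - a' * b) / (b * b')" unfolding x(1) y(1) by (simp add: diff_frac_eq)
    then show "x - y \<in> localization R P"
      using x y by (auto intro!: localization_memI rules(3,4) dest: Prules(3))
    have "x * y = (a * a') / (b * b')" unfolding x(1) y(1) by simp
    then show "x * y \<in> localization R P"
      using x y by (auto simp del: times_divide_times_eq intro!: localization_memI rules(3) dest: Prules(3))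
  qed
qed

lemma const_fract_simps:
  "const_fract 0 = 0" "const_fract 1 = 1"
  "const_fract (x - y) = const_fract x - const_fract y"
  "const_fract (x * y) = const_fract x * const_fract y"
  "const_fract (inverse x) = inverse (const_fract x)"
proof -
  show "const_fract 0 = 0" "const_fract 1 = 1"
    and *: "const_fract (x * y) = const_fract x * const_fract y" for x y
    unfolding const_fract_def by (simp_all flip: one_pCons to_fract_mult)
  show "const_fract (x - y) = const_fract x - const_fract y"
    unfolding const_fract_def by (simp flip: to_fract_diff)
  show "const_fract (inverse x) = inverse (const_fract x)"
  proof (cases "x = 0")
    case False
    then have "const_fract x * const_fract (inverse x) = 1"
      by (simp flip: * add: \<open>const_fract 1 = 1\<close>)
    then show ?thesis by (metis inverse_unique)
  qed (simp add: \<open>const_fract 0 = 0\<close>)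
qed

text \<open>
  For \<open>\<theta> = f/g\<close> put \<open>s = g + X\<^sup>n f\<close>. Both \<open>f/s\<close> and \<open>g/s\<close> lie in \<open>T\<close>, and \<open>g/s + X\<^sup>n f/s = 1\<close>, so one of
  them lies outside \<open>P\<close> and can serve as a denominator.
\<close>

lemma localization_Kronecker_total:
  assumes D: "quotient_field D = UNIV" and T: "is_subring T" "Kr (Zar D) \<subseteq> T"
    and P: "is_prime_ideal P T" and "\<theta> \<noteq> 0"
  shows "\<theta> \<in> localization T P \<or> inverse \<theta> \<in> localization T P"
proof -
  obtain f g where \<theta>: "\<theta> = to_fract f / to_fract g" "f \<noteq> 0" "g \<noteq> 0"
    using \<open>\<theta> \<noteq> 0\<close> by (rule fract_quotient_cases)
  define n where "n = Suc (degree g)"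
  define s where "s = g + monom 1 n * f"
  have mem: "to_fract f / to_fract s \<in> T" "to_fract g / to_fract s \<in> T" "to_fract (monom 1 n) \<in> T"
    using quotient_shifted_add_mem_Kr_Zar[OF D \<theta>(2,3), of n] monom_mem_Kr_Zar[OF D, of n] T(2)
    unfolding s_def n_def by auto
  have "coeff s (n + degree f) = lead_coeff f"
    unfolding s_def n_def by (simp add: coeff_monom_mult coeff_eq_0)
  then have "s \<noteq> 0" using \<theta>(2) by auto
  have "to_fract g / to_fract s + to_fract (monom 1 n) * (to_fract f / to_fract s) = to_fract s / to_fract s"
    unfolding s_def to_fract_add to_fract_mult add_divide_distrib by simp
  also have "\<dots> = 1" using \<open>s \<noteq> 0\<close> by simp
  finally have "\<not> (to_fract f / to_fract s \<in> P \<and> to_fract g / to_fract s \<in> P)"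
    using P mem(3) unfolding is_prime_ideal_def is_ideal_def by metis
  moreover have "\<theta> = (to_fract f / to_fract s) / (to_fract g / to_fract s)"
    "inverse \<theta> = (to_fract g / to_fract s) / (to_fract f / to_fract s)"
    unfolding \<theta>(1) using \<open>s \<noteq> 0\<close> by simp_all
  ultimately show ?thesis using mem(1,2) by (metis localization_memI)
qed

lemma to_fract_mem_subring:
  assumes L: "is_subring L" "to_fract (monom 1 1) \<in> L" and p: "\<And>i. const_fract (coeff p i) \<in> L"
  shows "to_fract p \<in> L"
  using p
proof (induction p rule: pCons_induct)
  case (pCons a p)
  have "to_fract p \<in> L" using pCons.IH pCons.prems[of "Suc _"] by simp
  moreover have "const_fract a \<in> L" using pCons.prems[of 0] by simp
  moreover have "to_fract (pCons a p) = const_fract a + to_fract (monom 1 1) * to_fract p"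
    unfolding const_fract_def by (simp add: monom_altdef flip: to_fract_mult to_fract_add)
  ultimately show ?case
    using L is_subring_add[OF L(1)] unfolding is_subring_def by simp
qed (use L in \<open>simp add: is_subring_def\<close>)

text \<open>
  The ring \<open>V\<close> is the contraction to \<open>K\<close> of the localization \<open>L\<close> of \<open>T\<close> at \<open>P\<close>. It contains \<open>D\<close>
  and inherits totality from \<open>L\<close>. As \<open>L\<close> contains \<open>X\<close>, it contains \<open>V[X]\<close>. To see that
  \<open>\<theta> = f/g\<close> in \<open>T\<close> belongs to \<open>V(X)\<close>, let \<open>c\<close> and \<open>d\<close> be the contents of \<open>f\<close> and \<open>g\<close>: the
  polynomial \<open>g/d\<close> and the inverse of \<open>f/c\<close> lie in \<open>L\<close>, so their product with \<open>\<theta>\<close>, which is \<open>c/d\<close>,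
  lies in \<open>L \<inter> K = V\<close>.
\<close>

lemma prime_ideal_center:
  assumes D: "is_subring D" "quotient_field D = UNIV" and T: "is_subring T" "Kr (Zar D) \<subseteq> T"
    and P: "is_prime_ideal P T"
  obtains V where "V \<in> Zar D" "T \<subseteq> trivial_extension V"
    "\<And>p. p \<in> polys_over V \<Longrightarrow> to_fract p \<in> localization T P"
proof -
  define L where "L = localization T P"
  define V where "V = {x. const_fract x \<in> L}"
  have L: "is_subring L" "T \<subseteq> L" using localization_subring[OF T(1) P] unfolding L_def by auto
  have rules: "0 \<in> L" "1 \<in> L" "\<And>x y. x \<in> L \<Longrightarrow> y \<in> L \<Longrightarrow> x * y \<in> L"
    "\<And>x y. x \<in> L \<Longrightarrow> y \<in> L \<Longrightarrow> x - y \<in> L"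
    using L(1) unfolding is_subring_def by auto
  have DV: "D \<subseteq> V"
  proof
    fix x assume "x \<in> D"
    have "const_fract x \<in> trivial_extension U" if "U \<in> Zar D" for U
      using field_valuation_ring.const_fract_mem_trivial_extension_iff[
          OF field_valuation_ring_Zar[OF that D(2)]] that \<open>x \<in> D\<close>
      unfolding Zar_def by blast
    then have "const_fract x \<in> Kr (Zar D)" unfolding Kr_def by blast
    then show "x \<in> V" unfolding V_def using T(2) L(2) by blast
  qed
  have q: "quotient_field V = UNIV"
    using D(2) DV unfolding quotient_field_def by blast
  have "is_subring V"
    unfolding is_subring_def V_def using rules by (simp add: const_fract_simps)
  moreover have "x \<in> V \<or> inverse x \<in> V" if "x \<noteq> 0" for x
  proof -
    have "const_fract x \<noteq> 0" using that unfolding const_fract_def by simp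
    then show ?thesis
      using localization_Kronecker_total[OF D(2) T P]
      unfolding V_def L_def by (simp add: const_fract_simps)
  qed
  ultimately have val: "valuation_ring V" unfolding valuation_ring_def by blast
  then have Zar: "V \<in> Zar D" unfolding Zar_def using q D(2) DV by simp
  interpret field_valuation_ring V by unfold_locales (fact val, fact q)
  have X: "to_fract (monom 1 1) \<in> L" using monom_mem_Kr_Zar[OF D(2)] T(2) L(2) by blast
  have polys: "to_fract p \<in> L" if "p \<in> polys_over V" for p
    using to_fract_mem_subring[OF L(1) X] that unfolding polys_over_def V_def by blast
  have "T \<subseteq> trivial_extension V"
  proof
    fix \<theta> assume "\<theta> \<in> T"
    then have \<theta>L: "\<theta> \<in> L" using L(2) by blast
    show "\<theta> \<in> trivial_extension V"
    proof (cases "\<theta> = 0")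
      case True
      then show ?thesis using trivial_extension_subring unfolding is_subring_def by blast
    next
      case False
      then obtain f g where \<theta>: "\<theta> = to_fract f / to_fract g" "f \<noteq> 0" "g \<noteq> 0"
        by (rule fract_quotient_cases)
      obtain c where c: "has_content f c" using \<theta>(2) by (rule has_content_exists)
      obtain d where d: "has_content g d" using \<theta>(3) by (rule has_content_exists)
      have nz: "c \<noteq> 0" "d \<noteq> 0" using c d has_content_nonzero by auto
      obtain i where i: "coeff f i \<noteq> 0" "c / coeff f i \<in> V" using c unfolding has_content_def by blast
      have "smult (1 / d) g \<in> polys_over V"
        using d unfolding has_content_def polys_over_def by simp
      then have 1: "to_fract (smult (1 / d) g) \<in> L" by (rule polys)
      have 2: "const_fract (coeff f i) / to_fract f \<in> L"
        using coeff_quotient_mem_Kr_Zar[OF D(2) \<theta>(2)] T(2) L(2) by blast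
      have 3: "const_fract (c / coeff f i) \<in> L" using i(2) unfolding V_def by blast
      have smult: "to_fract (smult (1 / d) g) = inverse (const_fract d) * to_fract g"
        by (simp add: const_fract_def inverse_eq_divide flip: to_fract_mult const_fract_simps(5)[unfolded const_fract_def inverse_eq_divide])
      have "\<theta> * to_fract (smult (1 / d) g) * (const_fract (coeff f i) / to_fract f)
              * const_fract (c / coeff f i) \<in> L"
        using \<theta>L 1 2 3 rules(3) by blast
      also have "\<theta> * to_fract (smult (1 / d) g) * (const_fract (coeff f i) / to_fract f)
              * const_fract (c / coeff f i) = const_fract (c / d)"
      proof -
        have "const_fract (coeff f i) \<noteq> 0" using i(1) unfolding const_fract_def by simp
        then show ?thesis
          unfolding \<theta>(1) smult divide_inverse[of _ "coeff f i"] divide_inverse[of c d] const_fract_simps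
          using \<theta>(2,3) by (simp add: field_simps)
      qed
      finally have "c / d \<in> V" unfolding V_def by blast
      then show ?thesis unfolding \<theta>(1) using quotient_mem_trivial_extension_iff[OF c d] by blast
    qed
  qed
  with Zar show thesis using polys unfolding L_def by (rule that)
qed

section \<open>Compactness\<close>

text \<open>
  Such a polynomial has content \<open>1\<close> over \<open>V\<close> if \<open>F \<subseteq> V\<close> and strictly larger content otherwise; its
  coefficient \<open>1\<close> ensures that its inverse lies in \<open>V(X)\<close> in either case.
\<close>

lemma poly_with_coeffs:
  assumes "finite (F :: 'k::field set)"
  obtains p where "coeff p 0 = 1" "\<And>i. coeff p i \<in> F \<union> {0, 1}" "\<And>x. x \<in> F \<Longrightarrow> \<exists>i. coeff p i = x"
proof -
  obtain xs where xs: "set xs = F" using finite_list[OF assms] by blast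
  show thesis
  proof
    show "coeff (Poly (1 # xs)) 0 = 1" by simp
    show "coeff (Poly (1 # xs)) i \<in> F \<union> {0, 1}" for i
      using xs by (auto simp: nth_default_def coeff_pCons split: nat.splits)
    show "\<exists>i. coeff (Poly (1 # xs)) i = x" if x: "x \<in> F" for x
    proof -
      obtain k where "k < length xs" "xs ! k = x" using x xs by (metis in_set_conv_nth)
      then show ?thesis by (intro exI[of _ "Suc k"]) (simp add: nth_default_def)
    qed
  qed
qed

text \<open>
  Call \<open>x \<in> T\<close> vanishing off a finite subfamily \<open>\<G>\<close> if it is a nonunit of \<open>V(X)\<close> for every
  \<open>V \<in> C\<close> that \<open>\<G>\<close> fails to cover. The elements that vanish off some finite \<open>\<G> \<subseteq> \<F>\<close> form an ideal
  of \<open>T\<close>, and \<open>1\<close> belongs to it precisely when \<open>\<F>\<close> has a finite subcover. If the ideal were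
  proper, a prime \<open>P\<close> containing it would give a member \<open>V\<close> of \<open>C\<close>, covered by some \<open>F \<in> \<F>\<close>. For
  the polynomial \<open>p\<close> with coefficients \<open>1\<close> and \<open>F\<close>, the inverse \<open>1/p\<close> vanishes off \<open>{F}\<close> and so
  lies in \<open>P\<close>, while \<open>p \<in> V[X]\<close> lies in the localization at \<open>P\<close>, which is impossible.
\<close>

lemma finite_subcover_Kronecker:
  assumes D: "is_subring D" "quotient_field D = UNIV" and T: "is_subring T" "Kr (Zar D) \<subseteq> T"
    and C: "C = {V \<in> Zar D. T \<subseteq> trivial_extension V}"
    and fin: "\<And>F. F \<in> \<F> \<Longrightarrow> finite F" and cover: "\<And>V. V \<in> C \<Longrightarrow> \<exists>F\<in>\<F>. F \<subseteq> V"
  obtains \<G> where "finite \<G>" "\<G> \<subseteq> \<F>" "\<And>V. V \<in> C \<Longrightarrow> \<exists>F\<in>\<G>. F \<subseteq> V"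
proof -
  define vanishes where
    "vanishes \<G> x \<longleftrightarrow> (\<forall>V\<in>C. (\<forall>F\<in>\<G>. \<not> F \<subseteq> V) \<longrightarrow> x \<in> max_ideal (trivial_extension V))"
    for \<G> x
  define J where "J = {x \<in> T. \<exists>\<G>. finite \<G> \<and> \<G> \<subseteq> \<F> \<and> vanishes \<G> x}"
  have fvr: "field_valuation_ring V" if "V \<in> C" for V
    using that field_valuation_ring_Zar[OF _ D(2)] unfolding C by blast
  have ideal: "is_ideal (max_ideal (trivial_extension V)) (trivial_extension V)" if "V \<in> C" for V
    using max_ideal_valuation_ring(1)[OF field_valuation_ring.trivial_extension_valuation_ring[OF fvr[OF that]]]
    unfolding is_maximal_ideal_def by blast
  have max_iff: "x \<in> max_ideal (trivial_extension V) \<longleftrightarrow>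
      x \<in> trivial_extension V \<and> (\<forall>y\<in>trivial_extension V. x * y \<noteq> 1)" if "V \<in> C" for V x
    unfolding max_ideal_valuation_ring(2)[OF field_valuation_ring.trivial_extension_valuation_ring[OF fvr[OF that]]]
    by blast
  have one: "1 \<in> trivial_extension V" if "V \<in> C" for V
    using field_valuation_ring.trivial_extension_subring[OF fvr[OF that]]
    unfolding is_subring_def by blast
  have J: "is_ideal J T"
    unfolding is_ideal_def
  proof (intro conjI ballI)
    show "J \<subseteq> T" unfolding J_def by blast
    have "vanishes {} 0" unfolding vanishes_def using ideal unfolding is_ideal_def by blast
    then show "0 \<in> J" unfolding J_def using T(1) unfolding is_subring_def by blast
    fix x y assume "x \<in> J" "y \<in> J"
    then obtain \<G> \<G>' where G: "finite \<G>" "\<G> \<subseteq> \<F>" "vanishes \<G> x" "finite \<G>'" "\<G>' \<subseteq> \<F>" "vanishes \<G>' y"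
      and xy: "x \<in> T" "y \<in> T"
      unfolding J_def by blast
    have "vanishes (\<G> \<union> \<G>') (x + y)"
      unfolding vanishes_def
    proof (intro ballI impI)
      fix V assume V: "V \<in> C" "\<forall>F\<in>\<G> \<union> \<G>'. \<not> F \<subseteq> V"
      then have "x \<in> max_ideal (trivial_extension V)" "y \<in> max_ideal (trivial_extension V)"
        using G(3,6) unfolding vanishes_def by simp_all
      then show "x + y \<in> max_ideal (trivial_extension V)"
        using ideal[OF V(1)] unfolding is_ideal_def by blast
    qed
    moreover have "finite (\<G> \<union> \<G>')" "\<G> \<union> \<G>' \<subseteq> \<F>" using G by auto
    moreover have "x + y \<in> T" using xy is_subring_add[OF T(1)] by blast
    ultimately show "x + y \<in> J" unfolding J_def by blast
  next
    fix r x assume "r \<in> T" "x \<in> J"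
    then obtain \<G> where G: "finite \<G>" "\<G> \<subseteq> \<F>" "vanishes \<G> x" "x \<in> T" unfolding J_def by blast
    have "vanishes \<G> (r * x)"
      unfolding vanishes_def
    proof (intro ballI impI)
      fix V assume V: "V \<in> C" "\<forall>F\<in>\<G>. \<not> F \<subseteq> V"
      then have "x \<in> max_ideal (trivial_extension V)" using G(3) unfolding vanishes_def by blast
      moreover have "r \<in> trivial_extension V" using V(1) \<open>r \<in> T\<close> unfolding C by blast
      ultimately show "r * x \<in> max_ideal (trivial_extension V)"
        using ideal[OF V(1)] unfolding is_ideal_def by blast
    qed
    moreover have "r * x \<in> T" using T(1) \<open>r \<in> T\<close> G(4) unfolding is_subring_def by blast
    ultimately show "r * x \<in> J" unfolding J_def using G by blast
  qed
  have "1 \<in> J"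
  proof (rule ccontr)
    assume "1 \<notin> J"
    then obtain P where P: "is_prime_ideal P T" "J \<subseteq> P" using prime_ideal_containing[OF T(1) J] by blast
    obtain V where V: "V \<in> Zar D" "T \<subseteq> trivial_extension V"
        "\<And>p. p \<in> polys_over V \<Longrightarrow> to_fract p \<in> localization T P"
      using prime_ideal_center[OF D T P(1)] by blast
    then have "V \<in> C" unfolding C by blast
    then obtain F where F: "F \<in> \<F>" "F \<subseteq> V" using cover by blast
    obtain p where p: "coeff p 0 = 1" "\<And>i. coeff p i \<in> F \<union> {0, 1}"
        "\<And>x. x \<in> F \<Longrightarrow> \<exists>i. coeff p i = x"
      using poly_with_coeffs[OF fin[OF F(1)]] by blast
    have p0: "p \<noteq> 0" using p(1) by auto
    have invT: "inverse (to_fract p) \<in> T"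
      using coeff_quotient_mem_Kr_Zar[OF D(2) p0, of 0] T(2) p(1)
      by (auto simp: const_fract_simps inverse_eq_divide)
    have "vanishes {F} (inverse (to_fract p))"
      unfolding vanishes_def
    proof (intro ballI impI)
      fix U assume U: "U \<in> C" "\<forall>F\<in>{F}. \<not> F \<subseteq> U"
      interpret field_valuation_ring U using fvr[OF U(1)] .
      have mem: "inverse (to_fract p) \<in> trivial_extension U" using invT U(1) unfolding C by blast
      have "y = to_fract p" if "inverse (to_fract p) * y = 1" for y
        using that p0 by (simp add: field_simps)
      moreover have "to_fract p \<notin> trivial_extension U"
      proof
        assume in_U: "to_fract p \<in> trivial_extension U"
        obtain c where c: "has_content p c" using p0 by (rule has_content_exists)
        have "c \<in> U"
          using quotient_mem_trivial_extension_iff[OF c has_content_const[of 1]] in_U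
          by (simp flip: one_pCons)
        then have "coeff p i \<in> U" for i
          using c mult_mem[of "coeff p i / c" c] unfolding has_content_def by auto
        then have "F \<subseteq> U" using p(3) by blast
        then show False using U(2) by blast
      qed
      ultimately show "inverse (to_fract p) \<in> max_ideal (trivial_extension U)"
        unfolding max_iff[OF U(1)] using mem by blast
    qed
    then have "inverse (to_fract p) \<in> J" unfolding J_def using invT F(1) by blast
    then have inP: "inverse (to_fract p) \<in> P" using P(2) by blast
    interpret field_valuation_ring V using V(1) D(2) by (rule field_valuation_ring_Zar)
    have "F \<union> {0, 1} \<subseteq> V" using F(2) zero_mem one_mem by simp
    then have "coeff p i \<in> V" for i using p(2) by (rule subsetD)
    then have "p \<in> polys_over V" unfolding polys_over_def by simp
    then have "to_fract p \<in> localization T P" by (rule V(3))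
    then obtain a b where ab: "to_fract p = a / b" "a \<in> T" "b \<in> T" "b \<notin> P"
      unfolding localization_def by blast
    have "b \<noteq> 0" using ab(4) P(1) unfolding is_prime_ideal_def is_ideal_def by blast
    then have "b = a * inverse (to_fract p)" using ab(1) p0 by (auto simp: field_simps)
    then have "b \<in> P" using P(1) ab(2) inP unfolding is_prime_ideal_def is_ideal_def by blast
    then show False using ab(4) by blast
  qed
  then obtain \<G> where \<G>: "finite \<G>" "\<G> \<subseteq> \<F>" "vanishes \<G> 1" unfolding J_def by blast
  have "\<exists>F\<in>\<G>. F \<subseteq> V" if "V \<in> C" for V
    using \<G>(3) max_iff[OF that] one[OF that] that unfolding vanishes_def by force
  with \<G>(1,2) show thesis by (rule that)
qed

text \<open>
  The sets \<open>{W. F \<subseteq> W}\<close> for finite \<open>F\<close> are closed under intersection, by taking unions of the \<open>F\<close>, so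
  they form a basis and not just a subbasis.
\<close>

lemma zariski_open_basis:
  assumes "openin (zariski_topology D) U" "V \<in> U" "V \<in> Zar D"
  obtains F where "finite F" "F \<subseteq> V" "{W \<in> Zar D. F \<subseteq> W} \<subseteq> U"
proof -
  have "generate_topology_on {{V \<in> Zar D. F \<subseteq> V} | F. finite F \<and> F \<subseteq> quotient_field D} U"
    using assms(1) unfolding zariski_topology_def openin_topology_generated_by_iff .
  then have "V \<in> U \<longrightarrow> (\<exists>F. finite F \<and> F \<subseteq> V \<and> {W \<in> Zar D. F \<subseteq> W} \<subseteq> U)"
  proof (induction rule: generate_topology_on.induct)
    case (Int a b)
    show ?case
    proof
      assume "V \<in> a \<inter> b"
      then obtain F G where "finite F" "F \<subseteq> V" "{W \<in> Zar D. F \<subseteq> W} \<subseteq> a"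
        "finite G" "G \<subseteq> V" "{W \<in> Zar D. G \<subseteq> W} \<subseteq> b"
        using Int.IH by auto
      then show "\<exists>F. finite F \<and> F \<subseteq> V \<and> {W \<in> Zar D. F \<subseteq> W} \<subseteq> a \<inter> b"
        by (intro exI[of _ "F \<union> G"]) auto
    qed
  next
    case (UN K)
    show ?case
    proof
      assume "V \<in> \<Union>K"
      then obtain k where k: "k \<in> K" "V \<in> k" by (elim UnionE)
      then obtain F where "finite F" "F \<subseteq> V" "{W \<in> Zar D. F \<subseteq> W} \<subseteq> k"
        using UN.IH[OF k(1)] by auto
      moreover have "k \<subseteq> \<Union>K" using k(1) by (rule Union_upper)
      ultimately show "\<exists>F. finite F \<and> F \<subseteq> V \<and> {W \<in> Zar D. F \<subseteq> W} \<subseteq> \<Union>K"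
        by (intro exI[of _ F] conjI) (assumption | erule order_trans)+
    qed
  next
    case (Basis s)
    then obtain F where "finite F" "s = {V \<in> Zar D. F \<subseteq> V}" by blast
    then show ?case by (intro impI exI[of _ F]) simp
  qed simp
  then obtain F where "finite F" "F \<subseteq> V" "{W \<in> Zar D. F \<subseteq> W} \<subseteq> U" using assms(2) by auto
  then show thesis by (rule that)
qed

lemma compactin_Kronecker:
  assumes D: "is_subring D" "quotient_field D = UNIV" and T: "is_subring T" "Kr (Zar D) \<subseteq> T"
  shows "compactin (zariski_topology D) {V \<in> Zar D. T \<subseteq> trivial_extension V}" (is "compactin _ ?C")
  unfolding compactin_def topspace_zariski_topology
proof (intro conjI allI impI)
  fix \<U> assume \<U>: "(\<forall>U\<in>\<U>. openin (zariski_topology D) U) \<and> ?C \<subseteq> \<Union>\<U>"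
  define \<F> where "\<F> = {F. finite F \<and> (\<exists>U\<in>\<U>. {W \<in> Zar D. F \<subseteq> W} \<subseteq> U)}"
  have cov: "\<exists>F\<in>\<F>. F \<subseteq> V" if "V \<in> ?C" for V
  proof -
    obtain U where "U \<in> \<U>" "V \<in> U" using \<U> \<open>V \<in> ?C\<close> by blast
    moreover have "openin (zariski_topology D) U" "V \<in> Zar D"
      using \<U> \<open>U \<in> \<U>\<close> \<open>V \<in> ?C\<close> by blast+
    ultimately obtain F where "finite F" "F \<subseteq> V" "{W \<in> Zar D. F \<subseteq> W} \<subseteq> U"
      using zariski_open_basis by metis
    then show ?thesis using \<open>U \<in> \<U>\<close> unfolding \<F>_def by blast
  qed
  have fin: "finite F" if "F \<in> \<F>" for F using that unfolding \<F>_def by blast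
  obtain \<G> where \<G>: "finite \<G>" "\<G> \<subseteq> \<F>" "\<And>V. V \<in> ?C \<Longrightarrow> \<exists>F\<in>\<G>. F \<subseteq> V"
    using finite_subcover_Kronecker[OF D T refl fin cov] by blast
  have "\<forall>F\<in>\<G>. \<exists>U. U \<in> \<U> \<and> {W \<in> Zar D. F \<subseteq> W} \<subseteq> U" using \<G>(2) unfolding \<F>_def by blast
  from bchoice[OF this]
  obtain u where u: "\<forall>F\<in>\<G>. u F \<in> \<U> \<and> {W \<in> Zar D. F \<subseteq> W} \<subseteq> u F" by (elim exE)
  have "?C \<subseteq> \<Union>(u ` \<G>)"
  proof
    fix V assume V: "V \<in> ?C"
    then obtain F where F: "F \<in> \<G>" "F \<subseteq> V" using \<G>(3) by blast
    then have "V \<in> {W \<in> Zar D. F \<subseteq> W}" using V by simp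
    then have "V \<in> u F" using u F(1) by (metis subsetD)
    then show "V \<in> \<Union>(u ` \<G>)" using F(1) by (rule UN_I[rotated])
  qed
  moreover have "u ` \<G> \<subseteq> \<U>" using u by (simp add: image_subset_iff)
  moreover have "finite (u ` \<G>)" using \<G>(1) by (rule finite_imageI)
  ultimately show "\<exists>\<V>. finite \<V> \<and> \<V> \<subseteq> \<U> \<and> ?C \<subseteq> \<Union>\<V>" by iprover
qed (rule Collect_restrict)

section \<open>Minimal members of \<open>\<K>(D)\<close>\<close>

theorem proposition6p1:
  fixes D :: "'k::field set"
  assumes "is_subring D"
    and "quotient_field D = UNIV"
    and "integrally_closed D"
    and "finite (Kronecker_function_rings D)"
    and "1 < card (Kronecker_function_rings D)"
  shows "\<exists>V. minimal_valuation_overring V D \<and> compactin (zariski_topology D) (Zar D - {V})"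
proof -
  let ?\<K> = "Kronecker_function_rings D" and ?A = "Kr (Zar D)"
  have const_Kr: "const_fract ` D \<subseteq> Kr \<Delta>" if "\<Delta> \<subseteq> Zar D" for \<Delta>
  proof -
    have "const_fract x \<in> trivial_extension U" if "x \<in> D" "U \<in> \<Delta>" for x U
      using field_valuation_ring.const_fract_mem_trivial_extension_iff[
          OF field_valuation_ring_Zar[OF _ assms(2)], of U] that \<open>\<Delta> \<subseteq> Zar D\<close>
      unfolding Zar_def by blast
    then show ?thesis unfolding Kr_def by blast
  qed
  have "\<not> ?\<K> \<subseteq> {?A}"
    using assms(5) card_mono[of "{?A}" ?\<K>] by auto
  then have "finite (?\<K> - {?A})" "?\<K> - {?A} \<noteq> {}" using assms(4) by auto
  from finite_has_minimal[OF this]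
  obtain T where T: "T \<in> ?\<K> - {?A}" and min: "\<And>S. S \<in> ?\<K> - {?A} \<Longrightarrow> S \<subseteq> T \<Longrightarrow> T = S"
    by metis
  from T obtain \<Delta> where \<Delta>: "\<Delta> \<noteq> {}" "\<Delta> \<subseteq> Zar D" "T = Kr \<Delta>"
    and TK: "T \<inter> const_fract ` quotient_field D = const_fract ` D" and "T \<noteq> ?A"
    unfolding Kronecker_function_rings_def by blast
  define C where "C = {V \<in> Zar D. T \<subseteq> trivial_extension V}"
  have AT: "?A \<subseteq> T" using \<Delta> unfolding Kr_def by blast
  \<comment> \<open>The intersection is the Kronecker function ring of \<open>\<Delta> \<union> {V}\<close>, still contracts to \<open>D\<close>, and is
      strictly smaller than \<open>T\<close>; so minimality of \<open>T\<close> leaves only \<open>A\<close>.\<close>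
  have inter: "T \<inter> trivial_extension V = ?A" if "V \<in> Zar D" "V \<notin> C" for V
  proof (rule ccontr)
    assume neq: "T \<inter> trivial_extension V \<noteq> ?A"
    have eq: "T \<inter> trivial_extension V = Kr (insert V \<Delta>)" unfolding \<Delta>(3) Kr_def by blast
    have "Kr (insert V \<Delta>) \<inter> const_fract ` quotient_field D = const_fract ` D"
      using const_Kr[of "insert V \<Delta>"] that(1) \<Delta>(2) TK eq by blast
    moreover have "insert V \<Delta> \<noteq> {} \<and> insert V \<Delta> \<subseteq> Zar D" using that(1) \<Delta>(2) by simp
    ultimately have "Kr (insert V \<Delta>) \<in> ?\<K>"
      unfolding Kronecker_function_rings_def mem_Collect_eq by (intro conjI exI[of _ "insert V \<Delta>"]) auto
    then have "T \<inter> trivial_extension V \<in> ?\<K> - {?A}" using neq unfolding eq by simp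
    then have "T = T \<inter> trivial_extension V" by (rule min) (rule Int_lower1)
    then show False using that unfolding C_def by blast
  qed
  \<comment> \<open>Otherwise \<open>\<alpha> \<in> T\<close> and \<open>\<beta> \<in> V\<close>, both outside \<open>W(X)\<close>, would combine to an element of
      \<open>T \<inter> V(X) = A\<close> outside \<open>W(X)\<close>.\<close>
  have sub: "V \<subseteq> W" if V: "V \<in> Zar D" "V \<notin> C" and W: "W \<in> Zar D" "W \<notin> C" for V W
  proof
    fix x assume "x \<in> V"
    interpret V: field_valuation_ring V using V(1) assms(2) by (rule field_valuation_ring_Zar)
    interpret W: field_valuation_ring W using W(1) assms(2) by (rule field_valuation_ring_Zar)
    show "x \<in> W"
    proof (rule ccontr)
      assume "x \<notin> W"
      define \<beta> where "\<beta> = const_fract x"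
      have \<beta>: "\<beta> \<in> trivial_extension V" "\<beta> \<notin> trivial_extension W"
        using \<open>x \<in> V\<close> \<open>x \<notin> W\<close> unfolding \<beta>_def
        by (simp_all add: V.const_fract_mem_trivial_extension_iff W.const_fract_mem_trivial_extension_iff)
      obtain \<alpha> where \<alpha>: "\<alpha> \<in> T" "\<alpha> \<notin> trivial_extension W" using W unfolding C_def by blast
      have "0 \<in> trivial_extension W" using W.trivial_extension_subring unfolding is_subring_def by blast
      then have "\<alpha> \<noteq> 0" "\<beta> \<noteq> 0" using \<alpha> \<beta> by auto
      then obtain \<gamma> where \<gamma>: "\<And>U. U \<in> Zar D \<Longrightarrow>
          \<gamma> \<in> trivial_extension U \<longleftrightarrow> \<alpha> \<in> trivial_extension U \<or> \<beta> \<in> trivial_extension U"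
        using generic_harmonic_sum[OF assms(2)] by blast
      have "\<gamma> \<in> T" using \<gamma> \<alpha>(1) \<Delta>(2) unfolding \<Delta>(3) Kr_def by blast
      then have "\<gamma> \<in> ?A" using \<gamma>[OF V(1)] \<beta>(1) inter[OF V] by blast
      then have "\<gamma> \<in> trivial_extension W" using W(1) unfolding Kr_def by blast
      then show False using \<gamma>[OF W(1)] \<alpha>(2) \<beta>(2) by blast
    qed
  qed
  have "\<exists>V\<in>Zar D. V \<notin> C"
  proof (rule ccontr)
    assume "\<not> (\<exists>V\<in>Zar D. V \<notin> C)"
    then have "T \<subseteq> ?A" unfolding C_def Kr_def by blast
    then show False using AT \<open>T \<noteq> ?A\<close> by blast
  qed
  then obtain V where V: "V \<in> Zar D" "V \<notin> C" by blast
  have C_eq: "C = Zar D - {V}" using V sub unfolding C_def by blast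
  have "minimal_valuation_overring V D"
    unfolding minimal_valuation_overring_def
  proof (intro conjI ballI impI)
    fix W assume W: "W \<in> Zar D" "W \<subseteq> V"
    show "W = V"
    proof (rule ccontr)
      assume "W \<noteq> V"
      then have "T \<subseteq> trivial_extension W" using W C_eq unfolding C_def by blast
      also have "\<dots> \<subseteq> trivial_extension V"
        using trivial_extension_mono field_valuation_ring_Zar[OF _ assms(2)] V(1) W by metis
      finally show False using V unfolding C_def by blast
    qed
  qed (fact V(1))
  moreover have "compactin (zariski_topology D) (Zar D - {V})"
    using compactin_Kronecker[OF assms(1,2) Kr_subring[OF \<Delta>(2) assms(2)]] AT
    unfolding \<Delta>(3) C_def[unfolded \<Delta>(3), symmetric] C_eq by blast
  ultimately show ?thesis by blast
qed

end
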